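(* Let $[H,G]$ be a bottom Boolean interval of finite groups with $\hat{\varphi}(H,G) \neq 0$. Then $[H,G]$ is linearly primitive.
   Context: An interval of finite groups $[H,G]$ is the lattice of all subgroups $K$ with $H \subseteq K \subseteq G$, where $G$ is a finite group and $H$ a subgroup. The bottom interval of $[H,G]$ is $[H,B]$, where $B$ is the join of all the atoms of $[H,G]$. A lattice is Boolean if it is isomorphic to the lattice of subsets of a finite set. $[H,G]$ is bottom Boolean if its bottom interval is a Boolean lattice. The dual Euler totient is $\hat{\varphi}(H,G) := \sum_{K \in [H,G]} \mu(H,K)\,|G:K|$, with $\mu$ the Möbius function of the lattice $[H,G]$. For a representation $V$ of $G$, a subgroup $K \subseteq G$ and a subspace $X \subseteq V$, put $V^K := \{v \in V \mid kv = v \ \forall k \in K\}$ and $G_{(X)} := \{g \in G \mid gx = x \ \forall x \in X\}$. The interval $[H,G]$ is linearly primitive if there is an irreducible complex representation $V$ of $G$ such that $G_{(V^H)} = H$. *)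

theory Defs
  imports
    "HOL-Algebra.Coset"
    "HOL-Algebra.Complete_Lattice"
    "Jordan_Normal_Form.VS_Connect"
begin

section \<open>Intervals of subgroups\<close>

definition subgroup_lattice :: "('a, 'b) monoid_scheme \<Rightarrow> 'a set gorder" where
  "subgroup_lattice G = \<lparr>carrier = {K. subgroup K G}, eq = (=), le = (\<subseteq>)\<rparr>"

definition subgroup_interval :: "('a, 'b) monoid_scheme \<Rightarrow> 'a set \<Rightarrow> 'a set \<Rightarrow> 'a set gorder" where
  "subgroup_interval G H K =
     (subgroup_lattice G) \<lparr>carrier := \<lbrace>H..K\<rbrace>\<^bsub>subgroup_lattice G\<^esub>\<rparr>"

definition index :: "('a, 'b) monoid_scheme \<Rightarrow> 'a set \<Rightarrow> nat" where
  "index G K = card (rcosets\<^bsub>G\<^esub> K)"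


section \<open>Order-theoretic notions\<close>

definition atoms :: "('a, 'b) gorder_scheme \<Rightarrow> 'a set" where
  "atoms L = {a \<in> carrier L. \<bottom>\<^bsub>L\<^esub> \<sqsubset>\<^bsub>L\<^esub> a \<and>
                (\<forall>x \<in> carrier L. \<not> (\<bottom>\<^bsub>L\<^esub> \<sqsubset>\<^bsub>L\<^esub> x \<and> x \<sqsubset>\<^bsub>L\<^esub> a))}"

definition powerset_lattice :: "'a set \<Rightarrow> 'a set gorder" where
  "powerset_lattice S = \<lparr>carrier = Pow S, eq = (=), le = (\<subseteq>)\<rparr>"

definition lattice_iso ::
    "('a, 'c) gorder_scheme \<Rightarrow> ('b, 'd) gorder_scheme \<Rightarrow> ('a \<Rightarrow> 'b) \<Rightarrow> bool" where
  "lattice_iso L M f \<longleftrightarrow>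
     bij_betw f (carrier L) (carrier M) \<and> join_pres L M f \<and> meet_pres L M f"

text \<open>Every finite set is in bijection with a finite set of natural numbers, so nothing is
  lost by taking the finite set to be of type \<^typ>\<open>nat set\<close>.\<close>

definition boolean_lattice :: "('a, 'b) gorder_scheme \<Rightarrow> bool" where
  "boolean_lattice L \<longleftrightarrow>
     (\<exists>(S :: nat set) f. finite S \<and> lattice_iso L (powerset_lattice S) f)"

text \<open>The Moebius function of a finite poset: \<open>\<mu>(x,x) = 1\<close>, and
  \<open>\<mu>(x,y) = - (\<Sum>x \<le> z < y. \<mu>(x,z))\<close> for \<open>x < y\<close>.  Finiteness and the order axioms are
  part of the guard to make the recursion terminate; the value is \<open>0\<close> outside the guard.\<close>

function mobius :: "('a, 'b) gorder_scheme \<Rightarrow> 'a \<Rightarrow> 'a \<Rightarrow> int" where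
  "mobius L x y =
     (if finite (carrier L) \<and> partial_order L \<and> x \<in> carrier L \<and> y \<in> carrier L \<and> x \<sqsubseteq>\<^bsub>L\<^esub> y
      then if x = y then 1
           else - (\<Sum>z \<in> {z \<in> carrier L. x \<sqsubseteq>\<^bsub>L\<^esub> z \<and> z \<sqsubset>\<^bsub>L\<^esub> y}. mobius L x z)
      else 0)"
  by pat_completeness auto
termination
proof (relation "measure (\<lambda>(L, x, y). card {z \<in> carrier L. z \<sqsubseteq>\<^bsub>L\<^esub> y})", goal_cases)
  case 1
  show ?case by simp
next
  case (2 L x y z)
  then interpret partial_order L by simp
  have z: "z \<in> carrier L" "z \<sqsubseteq>\<^bsub>L\<^esub> y" "z \<noteq> y" and y: "y \<in> carrier L"
    using 2 by (auto simp: lless_def)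
  have "y \<notin> {w \<in> carrier L. w \<sqsubseteq>\<^bsub>L\<^esub> z}"
    using z y le_antisym by auto
  moreover have "{w \<in> carrier L. w \<sqsubseteq>\<^bsub>L\<^esub> z} \<subseteq> {w \<in> carrier L. w \<sqsubseteq>\<^bsub>L\<^esub> y}"
    using z y le_trans by blast
  ultimately have "{w \<in> carrier L. w \<sqsubseteq>\<^bsub>L\<^esub> z} \<subset> {w \<in> carrier L. w \<sqsubseteq>\<^bsub>L\<^esub> y}"
    using y by auto
  then show ?case
    using 2 by (auto intro!: psubset_card_mono)
qed

declare mobius.simps [simp del]


section \<open>Bottom Boolean intervals and the dual Euler totient\<close>

definition bottom_interval :: "('a, 'b) monoid_scheme \<Rightarrow> 'a set \<Rightarrow> 'a set gorder" where
  "bottom_interval G H =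
     (let L = subgroup_interval G H (carrier G) in subgroup_interval G H (\<Squnion>\<^bsub>L\<^esub> (atoms L)))"

definition bottom_boolean :: "('a, 'b) monoid_scheme \<Rightarrow> 'a set \<Rightarrow> bool" where
  "bottom_boolean G H \<longleftrightarrow> boolean_lattice (bottom_interval G H)"

definition dual_euler_totient :: "('a, 'b) monoid_scheme \<Rightarrow> 'a set \<Rightarrow> int" where
  "dual_euler_totient G H =
     (let L = subgroup_interval G H (carrier G)
      in \<Sum>K \<in> carrier L. mobius L H K * int (index G K))"


section \<open>Complex representations\<close>

text \<open>A representation is a homomorphism \<open>G \<rightarrow> GL\<^sub>n(\<complex>)\<close>, with \<open>V = \<complex>\<^sup>n\<close>.  All irreducible
  complex representations of a finite group are of this form up to isomorphism.\<close>

definition GL :: "nat \<Rightarrow> complex mat monoid" where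
  "GL n = units_of (ring_mat TYPE(complex) n ())"

definition representation :: "('a, 'b) monoid_scheme \<Rightarrow> nat \<Rightarrow> ('a \<Rightarrow> complex mat) \<Rightarrow> bool" where
  "representation G n \<rho> \<longleftrightarrow> \<rho> \<in> hom G (GL n)"

definition invariant_subspace ::
    "('a, 'b) monoid_scheme \<Rightarrow> nat \<Rightarrow> ('a \<Rightarrow> complex mat) \<Rightarrow> complex vec set \<Rightarrow> bool" where
  "invariant_subspace G n \<rho> W \<longleftrightarrow>
     VectorSpace.subspace class_ring W (module_vec TYPE(complex) n) \<and>
     (\<forall>g \<in> carrier G. \<forall>w \<in> W. \<rho> g *\<^sub>v w \<in> W)"

definition irreducible_representation ::
    "('a, 'b) monoid_scheme \<Rightarrow> nat \<Rightarrow> ('a \<Rightarrow> complex mat) \<Rightarrow> bool" where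
  "irreducible_representation G n \<rho> \<longleftrightarrow>
     representation G n \<rho> \<and> n > 0 \<and>
     (\<forall>W. invariant_subspace G n \<rho> W \<longrightarrow> W = {0\<^sub>v n} \<or> W = carrier_vec n)"

definition fixed_vectors :: "nat \<Rightarrow> ('a \<Rightarrow> complex mat) \<Rightarrow> 'a set \<Rightarrow> complex vec set" where
  "fixed_vectors n \<rho> K = {v \<in> carrier_vec n. \<forall>k \<in> K. \<rho> k *\<^sub>v v = v}"

definition pointwise_stabilizer ::
    "('a, 'b) monoid_scheme \<Rightarrow> ('a \<Rightarrow> complex mat) \<Rightarrow> complex vec set \<Rightarrow> 'a set" where
  "pointwise_stabilizer G \<rho> S = {g \<in> carrier G. \<forall>x \<in> S. \<rho> g *\<^sub>v x = x}"

definition linearly_primitive :: "('a, 'b) monoid_scheme \<Rightarrow> 'a set \<Rightarrow> bool" where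
  "linearly_primitive G H \<longleftrightarrow>
     (\<exists>n \<rho>. irreducible_representation G n \<rho> \<and>
            pointwise_stabilizer G \<rho> (fixed_vectors n \<rho> H) = H)"

end

theory Submission
  imports Defs "Jordan_Normal_Form.DL_Rank" "HOL-Algebra.Generated_Groups"
begin

text \<open>For a representation \<open>V\<close> of \<open>G\<close> put \<open>d V K = dim (V\<^sup>K)\<close>. If \<open>[H, G]\<close> is not linearly primitive and
  \<open>V\<close> is irreducible, then \<open>V\<^sup>H = V\<^sup>S\<close> for the strictly larger subgroup \<open>S\<close> that stabilizes \<open>V\<^sup>H\<close>
  pointwise, hence \<open>d V K = d V (K \<squnion> S)\<close> for all \<open>K\<close> in \<open>[H, G]\<close>. Weisner's theorem, which says that
  \<open>\<mu>(H, K)\<close> sums to zero over all \<open>K\<close> with a given join \<open>K \<squnion> S\<close>, then yields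
  \<open>(\<Sum>K. \<mu>(H, K) * d V K) = 0\<close>. This identity is additive in \<open>V\<close>, so it passes to all
  representations; for the regular one, \<open>d V K = |G : K|\<close> and the sum is the dual Euler totient.
  Replacing the dimension by the average over \<open>K\<close> of the character of \<open>V\<close> gives additivity along an
  invariant subspace directly from a block triangular form, without complete reducibility.\<close>

section \<open>Moebius sums along the fibres of a join map\<close>

section \<open>Moebius functions\<close>

text \<open>This is the recursion for \<open>mobius\<close> with its value at \<open>y\<close> moved
  to the other side; as \<open>b\<close> is least, the lower bound in the recursion holds
  automatically.\<close>

lemma sum_mobius_lower_set:
  assumes "partial_order L" "finite (carrier L)" "b \<in> carrier L" "y \<in> carrier L" "b \<noteq> y"
    and least: "\<And>x. x \<in> carrier L \<Longrightarrow> b \<sqsubseteq>\<^bsub>L\<^esub> x"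
  shows "(\<Sum>x \<in> {x \<in> carrier L. x \<sqsubseteq>\<^bsub>L\<^esub> y}. mobius L b x) = 0"
proof -
  interpret partial_order L by fact
  let ?S = "{z \<in> carrier L. b \<sqsubseteq>\<^bsub>L\<^esub> z \<and> z \<sqsubset>\<^bsub>L\<^esub> y}"
  have eq: "{x \<in> carrier L. x \<sqsubseteq>\<^bsub>L\<^esub> y} = insert y ?S"
    using assms by (auto simp: lless_def eq_is_equal)
  have "finite ?S" "y \<notin> ?S"
    using assms by (auto simp: lless_def eq_is_equal)
  then show ?thesis
    unfolding eq using assms
    by (simp add: mobius.simps[of L b y])
qed

text \<open>The map \<open>j\<close> stands for the join with \<open>a\<close>, described by its
  universal property \<open>j_le\<close>. Induction on the size of the lower set of
  \<open>y\<close>: the Moebius values below \<open>y\<close> sum to zero, and sorting them by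
  \<open>j x\<close> leaves only the class of \<open>y\<close>, because the classes of smaller
  elements vanish by induction. If \<open>a\<close> is not below \<open>y\<close>, the class of
  \<open>y\<close> is empty.\<close>

theorem weisner:
  assumes po: "partial_order L" and fin: "finite (carrier L)"
    and b: "b \<in> carrier L" and least: "\<And>x. x \<in> carrier L \<Longrightarrow> b \<sqsubseteq>\<^bsub>L\<^esub> x"
    and a: "a \<in> carrier L" "a \<noteq> b"
    and j: "\<And>x. x \<in> carrier L \<Longrightarrow> j x \<in> carrier L"
    and j_le: "\<And>x y. x \<in> carrier L \<Longrightarrow> y \<in> carrier L \<Longrightarrow> j x \<sqsubseteq>\<^bsub>L\<^esub> y \<longleftrightarrow> x \<sqsubseteq>\<^bsub>L\<^esub> y \<and> a \<sqsubseteq>\<^bsub>L\<^esub> y"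
    and y: "y \<in> carrier L"
  shows "(\<Sum>x \<in> {x \<in> carrier L. j x = y}. mobius L b x) = 0"
  using y
proof (induction "card {z \<in> carrier L. z \<sqsubseteq>\<^bsub>L\<^esub> y}" arbitrary: y rule: less_induct)
  case less
  interpret partial_order L by fact
  show ?case
  proof (cases "a \<sqsubseteq>\<^bsub>L\<^esub> y")
    case False
    then have "{x \<in> carrier L. j x = y} = {}"
      using j_le[of _ y] j less.prems by auto
    then show ?thesis by (simp only: sum.empty)
  next
    case True
    let ?D = "{x \<in> carrier L. x \<sqsubseteq>\<^bsub>L\<^esub> y}"
    have "b \<noteq> y"
      using True a b least le_antisym by blast
    then have "0 = (\<Sum>x \<in> ?D. mobius L b x)"
      using sum_mobius_lower_set[OF po fin b \<open>y \<in> carrier L\<close>] least by simp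
    \<comment> \<open>As \<open>a\<close> lies below \<open>y\<close>, \<open>x\<close> is in
      \<open>?D\<close> iff \<open>j x\<close> is. So \<open>j\<close> maps \<open>?D\<close> to
      itself, and the fibre over any \<open>z\<close> in \<open>?D\<close> lies entirely in
      \<open>?D\<close>.\<close>
    also have "\<dots> = (\<Sum>z \<in> ?D. \<Sum>x \<in> {x \<in> ?D. j x = z}. mobius L b x)"
      using fin j j_le True less.prems by (intro sum.group[symmetric]) auto
    also have "\<dots> = (\<Sum>z \<in> ?D. \<Sum>x \<in> {x \<in> carrier L. j x = z}. mobius L b x)"
      using j_le less.prems by (intro sum.cong) auto
    also have "\<dots> = (\<Sum>z \<in> {y}. \<Sum>x \<in> {x \<in> carrier L. j x = z}. mobius L b x)"
    proof (rule sum.mono_neutral_right)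
      show "\<forall>z \<in> ?D - {y}. (\<Sum>x \<in> {x \<in> carrier L. j x = z}. mobius L b x) = 0"
      proof
        fix z assume z: "z \<in> ?D - {y}"
        have "{w \<in> carrier L. w \<sqsubseteq>\<^bsub>L\<^esub> z} \<subset> ?D"
          using z less.prems le_trans[of _ z y] le_antisym[of y z] by blast
        then have "card {w \<in> carrier L. w \<sqsubseteq>\<^bsub>L\<^esub> z} < card ?D"
          using fin by (intro psubset_card_mono) auto
        then show "(\<Sum>x \<in> {x \<in> carrier L. j x = z}. mobius L b x) = 0"
          using less.hyps z by blast
      qed
    qed (use fin less.prems in auto)
    finally show ?thesis by simp
  qed
qed

text \<open>Since \<open>f x = f (j x)\<close>, \<open>f\<close> is constant on each fibre of
  \<open>j\<close>, and the Moebius values on each fibre cancel.\<close>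

corollary sum_mobius_join_invariant:
  fixes f :: "'a \<Rightarrow> 'c::comm_ring_1"
  assumes po: "partial_order L" and fin: "finite (carrier L)"
    and b: "b \<in> carrier L" and least: "\<And>x. x \<in> carrier L \<Longrightarrow> b \<sqsubseteq>\<^bsub>L\<^esub> x"
    and a: "a \<in> carrier L" "a \<noteq> b"
    and j: "\<And>x. x \<in> carrier L \<Longrightarrow> j x \<in> carrier L"
    and j_le: "\<And>x y. x \<in> carrier L \<Longrightarrow> y \<in> carrier L \<Longrightarrow> j x \<sqsubseteq>\<^bsub>L\<^esub> y \<longleftrightarrow> x \<sqsubseteq>\<^bsub>L\<^esub> y \<and> a \<sqsubseteq>\<^bsub>L\<^esub> y"
    and f: "\<And>x. x \<in> carrier L \<Longrightarrow> f (j x) = f x"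
  shows "(\<Sum>x \<in> carrier L. of_int (mobius L b x) * f x) = 0"
proof -
  have "(\<Sum>x \<in> carrier L. of_int (mobius L b x) * f x) =
      (\<Sum>y \<in> carrier L. \<Sum>x \<in> {x \<in> carrier L. j x = y}. of_int (mobius L b x) * f x)"
    using fin j by (intro sum.group[symmetric]) auto
  also have "\<dots> = (\<Sum>y \<in> carrier L. of_int (\<Sum>x \<in> {x \<in> carrier L. j x = y}. mobius L b x) * f y)"
    unfolding of_int_sum sum_distrib_right using f by (intro sum.cong) auto
  also have "\<dots> = 0"
    using weisner[OF po fin b least a j j_le] by (intro sum.neutral) auto
  finally show ?thesis .
qed


section \<open>The subgroups containing H as a poset, and their joins\<close>

section \<open>Intervals of subgroups\<close>

lemma carrier_subgroup_interval:
  "carrier (subgroup_interval G H (carrier G)) = {K. subgroup K G \<and> H \<subseteq> K}"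
  using subgroup.subset
  by (fastforce simp: subgroup_interval_def subgroup_lattice_def at_least_at_most_def)

lemma le_subgroup_interval [simp]: "le (subgroup_interval G H K) = (\<subseteq>)"
  by (simp add: subgroup_interval_def subgroup_lattice_def)

lemma partial_order_subgroup_interval: "partial_order (subgroup_interval G H K)"
  by unfold_locales (auto simp: subgroup_interval_def subgroup_lattice_def)

text \<open>Provides the property \<open>j_le\<close> for the join of subgroups.\<close>

lemma (in group) generate_Un_subset_iff:
  assumes "subgroup K G" "subgroup L G" "subgroup M G"
  shows "generate G (K \<union> L) \<subseteq> M \<longleftrightarrow> K \<subseteq> M \<and> L \<subseteq> M"
  using generate_subgroup_incl[of "K \<union> L" M] generate.incl[of _ "K \<union> L" G] assms by blast


section \<open>Averaging projections and their traces\<close>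

section \<open>Traces and fixed vectors\<close>

definition trace :: "'a::comm_monoid_add mat \<Rightarrow> 'a" where
  "trace A = (\<Sum>i<dim_row A. A $$ (i, i))"

lemma trace_mult_comm:
  fixes A B :: "'a::comm_semiring_0 mat"
  assumes "A \<in> carrier_mat m n" "B \<in> carrier_mat n m"
  shows "trace (A * B) = trace (B * A)"
proof -
  have "trace (A * B) = (\<Sum>i<m. \<Sum>j<n. A $$ (i, j) * B $$ (j, i))"
    using assms by (auto simp: trace_def scalar_prod_def atLeast0LessThan intro!: sum.cong)
  also have "\<dots> = (\<Sum>j<n. \<Sum>i<m. B $$ (j, i) * A $$ (i, j))"
    by (subst sum.swap) (simp add: mult.commute)
  also have "\<dots> = trace (B * A)"
    using assms by (auto simp: trace_def scalar_prod_def atLeast0LessThan intro!: sum.cong)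
  finally show ?thesis .
qed

text \<open>Replaces membership in \<open>GL n\<close> by matrix equations: multiplicativity and the
  value at the identity make \<open>\<rho> (inv g)\<close> a two-sided inverse of
  \<open>\<rho> g\<close>.\<close>

lemma representation_iff:
  assumes "group G"
  shows "representation G n \<rho> \<longleftrightarrow>
    (\<forall>g \<in> carrier G. \<rho> g \<in> carrier_mat n n) \<and>
    (\<forall>g \<in> carrier G. \<forall>h \<in> carrier G. \<rho> (g \<otimes>\<^bsub>G\<^esub> h) = \<rho> g * \<rho> h) \<and>
    \<rho> \<one>\<^bsub>G\<^esub> = 1\<^sub>m n"
proof -
  interpret group G by fact
  interpret R: ring "ring_mat TYPE(complex) n ()" by (rule ring_mat)
  have GL: "group (GL n)"
    unfolding GL_def by (rule R.units_group)
  note simps = GL_def units_of_def ring_mat_simps Units_def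
  show ?thesis
  proof safe
    assume hom: "representation G n \<rho>"
    then have hom': "\<rho> \<in> hom G (GL n)"
      by (simp add: representation_def)
    show "\<rho> g \<in> carrier_mat n n" if "g \<in> carrier G" for g
      using hom_in_carrier[OF hom' that] by (simp add: simps)
    show "\<rho> (g \<otimes>\<^bsub>G\<^esub> h) = \<rho> g * \<rho> h" if "g \<in> carrier G" "h \<in> carrier G" for g h
      using hom_mult[OF hom' that] by (simp add: simps)
    show "\<rho> \<one>\<^bsub>G\<^esub> = 1\<^sub>m n"
      using hom_one[OF hom' is_group GL] by (simp add: simps)
  next
    assume closed: "\<forall>g \<in> carrier G. \<rho> g \<in> carrier_mat n n"
      and mult: "\<forall>g \<in> carrier G. \<forall>h \<in> carrier G. \<rho> (g \<otimes>\<^bsub>G\<^esub> h) = \<rho> g * \<rho> h"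
      and one: "\<rho> \<one>\<^bsub>G\<^esub> = 1\<^sub>m n"
    have "\<rho> (inv\<^bsub>G\<^esub> g) * \<rho> g = 1\<^sub>m n" "\<rho> g * \<rho> (inv\<^bsub>G\<^esub> g) = 1\<^sub>m n" if "g \<in> carrier G" for g
      using that mult[rule_format, of "inv\<^bsub>G\<^esub> g" g] mult[rule_format, of g "inv\<^bsub>G\<^esub> g"] one by auto
    then show "representation G n \<rho>"
      using closed mult inv_closed unfolding representation_def hom_def
      by (auto simp: simps) blast
  qed
qed

locale group_representation = group G for G (structure) +
  fixes n :: nat and \<rho> :: "'a \<Rightarrow> complex mat"
  assumes rep_closed [simp]: "g \<in> carrier G \<Longrightarrow> \<rho> g \<in> carrier_mat n n"
    and rep_mult: "g \<in> carrier G \<Longrightarrow> h \<in> carrier G \<Longrightarrow> \<rho> (g \<otimes> h) = \<rho> g * \<rho> h"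
    and rep_one [simp]: "\<rho> \<one> = 1\<^sub>m n"

lemma group_representation_iff:
  "group_representation G n \<rho> \<longleftrightarrow> group G \<and> representation G n \<rho>"
  using representation_iff[of G n \<rho>]
  by (auto simp: group_representation_def group_representation_axioms_def)

text \<open>The inner product of the character restricted to \<open>K\<close> with the trivial
  character of \<open>K\<close>.\<close>

definition mean_trace :: "('a \<Rightarrow> complex mat) \<Rightarrow> 'a set \<Rightarrow> complex" where
  "mean_trace \<rho> K = (\<Sum>k \<in> K. trace (\<rho> k)) / of_nat (card K)"

text \<open>The projection of V onto the vectors fixed by \<open>K\<close>, when \<open>K\<close> is
  a finite subgroup.\<close>

definition average :: "nat \<Rightarrow> ('a \<Rightarrow> complex mat) \<Rightarrow> 'a set \<Rightarrow> complex mat" where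
  "average n \<rho> K = mat n n (\<lambda>(i, j). (\<Sum>k \<in> K. \<rho> k $$ (i, j)) / of_nat (card K))"

lemma average_carrier [simp]: "average n \<rho> K \<in> carrier_mat n n"
  by (simp add: average_def)

context group_representation
begin

lemma trace_average:
  assumes "K \<subseteq> carrier G"
  shows "trace (average n \<rho> K) = mean_trace \<rho> K"
proof -
  have "dim_row (\<rho> k) = n" if "k \<in> K" for k
    using that assms rep_closed by blast
  then show ?thesis
    by (simp add: trace_def average_def mean_trace_def sum_divide_distrib[symmetric] sum.swap[of _ K])
qed

text \<open>Left multiplication by \<open>k\<close> permutes \<open>K\<close>, so it only reorders
  the sum.\<close>

lemma rep_times_average:
  assumes K: "subgroup K G" and k: "k \<in> K"
  shows "\<rho> k * average n \<rho> K = average n \<rho> K"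
proof (rule eq_matI)
  interpret K: subgroup K G by fact
  have \<rho>k: "\<rho> k \<in> carrier_mat n n"
    using k by simp
  fix i j assume "i < dim_row (average n \<rho> K)" "j < dim_col (average n \<rho> K)"
  then have ij: "i < n" "j < n"
    by (simp_all add: average_def)
  have "(\<rho> k * average n \<rho> K) $$ (i, j) =
      (\<Sum>l<n. \<rho> k $$ (i, l) * ((\<Sum>h \<in> K. \<rho> h $$ (l, j)) / of_nat (card K)))"
    using ij \<rho>k by (simp add: scalar_prod_def average_def atLeast0LessThan)
  also have "\<dots> = (\<Sum>h \<in> K. \<Sum>l<n. \<rho> k $$ (i, l) * \<rho> h $$ (l, j)) / of_nat (card K)"
    by (subst sum.swap) (simp add: sum_distrib_left sum_divide_distrib)
  also have "(\<Sum>h \<in> K. \<Sum>l<n. \<rho> k $$ (i, l) * \<rho> h $$ (l, j)) = (\<Sum>h \<in> K. \<rho> (k \<otimes> h) $$ (i, j))"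
  proof (rule sum.cong)
    fix h assume "h \<in> K"
    then have "\<rho> h \<in> carrier_mat n n" "\<rho> (k \<otimes> h) = \<rho> k * \<rho> h"
      using k by (auto simp: rep_mult)
    then show "(\<Sum>l<n. \<rho> k $$ (i, l) * \<rho> h $$ (l, j)) = \<rho> (k \<otimes> h) $$ (i, j)"
      using ij \<rho>k by (simp add: scalar_prod_def atLeast0LessThan)
  qed simp
  also have "\<dots> = (\<Sum>h \<in> K. \<rho> h $$ (i, j))"
    by (rule sum.reindex_bij_witness[of _ "\<lambda>h. inv k \<otimes> h" "\<lambda>h. k \<otimes> h"])
      (use k in \<open>auto simp: m_assoc[symmetric]\<close>)
  finally show "(\<rho> k * average n \<rho> K) $$ (i, j) = average n \<rho> K $$ (i, j)"
    using ij by (simp add: average_def)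
qed (use rep_closed[OF subgroup.mem_carrier[OF K k]] in \<open>auto simp: average_def\<close>)

lemma average_times:
  assumes K: "subgroup K G" "finite K" and A: "A \<in> carrier_mat n m"
    and fixed: "\<And>k. k \<in> K \<Longrightarrow> \<rho> k * A = A"
  shows "average n \<rho> K * A = A"
proof (rule eq_matI)
  interpret K: subgroup K G by fact
  \<comment> \<open>The sum of \<open>\<rho> k * A\<close> is \<open>card K\<close> copies of
    \<open>A\<close>; division by zero being zero, cancelling this factor requires it to be
    nonzero.\<close>
  have card: "card K \<noteq> 0"
    using K.one_closed K(2) by (metis card_eq_0_iff empty_iff)
  fix i j assume "i < dim_row A" "j < dim_col A"
  then have ij: "i < n" "j < m"
    using A by auto
  have "(average n \<rho> K * A) $$ (i, j) =
      (\<Sum>l<n. (\<Sum>k \<in> K. \<rho> k $$ (i, l)) / of_nat (card K) * A $$ (l, j))"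
    using ij A by (simp add: scalar_prod_def average_def atLeast0LessThan)
  also have "\<dots> = (\<Sum>k \<in> K. \<Sum>l<n. \<rho> k $$ (i, l) * A $$ (l, j)) / of_nat (card K)"
    by (subst sum.swap) (simp add: sum_distrib_right sum_divide_distrib)
  also have "(\<Sum>k \<in> K. \<Sum>l<n. \<rho> k $$ (i, l) * A $$ (l, j)) = (\<Sum>k \<in> K. (\<rho> k * A) $$ (i, j))"
  proof (rule sum.cong)
    fix k assume "k \<in> K"
    then have "\<rho> k \<in> carrier_mat n n"
      by simp
    then show "(\<Sum>l<n. \<rho> k $$ (i, l) * A $$ (l, j)) = (\<rho> k * A) $$ (i, j)"
      using ij A by (simp add: scalar_prod_def atLeast0LessThan)
  qed simp
  finally show "(average n \<rho> K * A) $$ (i, j) = A $$ (i, j)"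
    using fixed card by simp
qed (use A in \<open>auto simp: average_def\<close>)

lemma col_average_fixed:
  assumes "subgroup K G" "j < n"
  shows "col (average n \<rho> K) j \<in> fixed_vectors n \<rho> K"
proof -
  have "\<rho> k *\<^sub>v col (average n \<rho> K) j = col (average n \<rho> K) j" if "k \<in> K" for k
  proof -
    have "\<rho> k \<in> carrier_mat n n"
      using that assms by (simp add: subgroup.mem_carrier)
    then have "\<rho> k *\<^sub>v col (average n \<rho> K) j = col (\<rho> k * average n \<rho> K) j"
      using assms by (subst col_mult2[OF _ average_carrier]) auto
    then show ?thesis
      using rep_times_average[OF assms(1) that] by simp
  qed
  then show ?thesis
    using assms(2) by (auto simp: fixed_vectors_def intro!: col_carrier_vec[of _ n])
qed

text \<open>The columns of the average over \<open>L\<close> are fixed by \<open>L\<close>, hence by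
  \<open>K\<close>, so averaging them over \<open>K\<close> changes nothing.\<close>

lemma average_times_average:
  assumes K: "subgroup K G" "finite K" and L: "subgroup L G"
    and fixed: "fixed_vectors n \<rho> L \<subseteq> fixed_vectors n \<rho> K"
  shows "average n \<rho> K * average n \<rho> L = average n \<rho> L"
proof (rule average_times[OF K average_carrier])
  fix k assume k: "k \<in> K"
  have \<rho>k: "\<rho> k \<in> carrier_mat n n"
    using k K by (simp add: subgroup.mem_carrier)
  show "\<rho> k * average n \<rho> L = average n \<rho> L"
  proof (rule mat_col_eqI)
    fix j assume "j < dim_col (average n \<rho> L)"
    then have j: "j < n" by (simp add: average_def)
    then have "\<rho> k *\<^sub>v col (average n \<rho> L) j = col (average n \<rho> L) j"
      using subsetD[OF fixed col_average_fixed[OF L j]] k by (simp add: fixed_vectors_def)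
    then show "col (\<rho> k * average n \<rho> L) j = col (average n \<rho> L) j"
      using j \<rho>k by (subst col_mult2[OF _ average_carrier]) auto
  qed (use \<rho>k in \<open>auto simp: average_def\<close>)
qed

text \<open>The mean trace is the dimension of the space of fixed vectors, but only its invariance is
  needed: two projections \<open>P\<close>, \<open>Q\<close> with the same image satisfy \<open>P * Q = Q\<close> and \<open>Q * P = P\<close>.\<close>

lemma mean_trace_eq:
  assumes "subgroup K G" "finite K" "subgroup L G" "finite L"
    and "fixed_vectors n \<rho> K = fixed_vectors n \<rho> L"
  shows "mean_trace \<rho> K = mean_trace \<rho> L"
proof -
  have "trace (average n \<rho> K) = trace (average n \<rho> L)"
    using assms average_times_average[of K L] average_times_average[of L K]
      trace_mult_comm[OF average_carrier average_carrier, of n \<rho> K \<rho> L] by simp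
  then show ?thesis
    using assms by (simp add: trace_average subgroup.subset)
qed

section \<open>Pointwise stabilizers and fixed vectors of generated subgroups\<close>

lemma mult_vec_rep_mult:
  assumes "g \<in> carrier G" "h \<in> carrier G" "v \<in> carrier_vec n"
  shows "\<rho> (g \<otimes> h) *\<^sub>v v = \<rho> g *\<^sub>v (\<rho> h *\<^sub>v v)"
  using assms assoc_mult_mat_vec[OF rep_closed rep_closed] by (simp add: rep_mult)

lemma rep_inv_fixes:
  assumes "g \<in> carrier G" "v \<in> carrier_vec n" "\<rho> g *\<^sub>v v = v"
  shows "\<rho> (inv g) *\<^sub>v v = v"
proof -
  have "\<rho> (inv g) *\<^sub>v v = \<rho> (inv g) *\<^sub>v (\<rho> g *\<^sub>v v)"
    using assms by simp
  also have "\<dots> = v"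
    using assms mult_vec_rep_mult[of "inv g" g v] by simp
  finally show ?thesis .
qed

lemma subgroup_pointwise_stabilizer:
  assumes "S \<subseteq> carrier_vec n"
  shows "subgroup (pointwise_stabilizer G \<rho> S) G"
proof (rule subgroupI)
  show "pointwise_stabilizer G \<rho> S \<noteq> {}"
    using assms unfolding pointwise_stabilizer_def by (auto intro!: exI[of _ \<one>])
qed (use assms in \<open>auto simp: pointwise_stabilizer_def mult_vec_rep_mult subset_eq intro!: rep_inv_fixes\<close>)

text \<open>A vector fixed by \<open>S\<close> has a stabilizer that is a subgroup containing
  \<open>S\<close>, hence containing everything \<open>S\<close> generates.\<close>

lemma fixed_vectors_generate:
  assumes "S \<subseteq> carrier G"
  shows "fixed_vectors n \<rho> (generate G S) = fixed_vectors n \<rho> S"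
proof
  show "fixed_vectors n \<rho> (generate G S) \<subseteq> fixed_vectors n \<rho> S"
    by (auto simp: fixed_vectors_def generate.incl)
  show "fixed_vectors n \<rho> S \<subseteq> fixed_vectors n \<rho> (generate G S)"
  proof
    fix v assume v: "v \<in> fixed_vectors n \<rho> S"
    then have "S \<subseteq> pointwise_stabilizer G \<rho> {v}"
      using assms by (auto simp: fixed_vectors_def pointwise_stabilizer_def)
    moreover have "subgroup (pointwise_stabilizer G \<rho> {v}) G"
      using v by (intro subgroup_pointwise_stabilizer) (auto simp: fixed_vectors_def)
    ultimately have "generate G S \<subseteq> pointwise_stabilizer G \<rho> {v}"
      by (rule generate_subgroup_incl)
    then show "v \<in> fixed_vectors n \<rho> (generate G S)"
      using v by (auto simp: fixed_vectors_def pointwise_stabilizer_def)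
  qed
qed

end

section \<open>Splitting along an invariant subspace by block triangular matrices\<close>

section \<open>Reducible representations\<close>

text \<open>The columns of \<open>P\<close> are a basis of the whole space that starts with a basis
  of \<open>W\<close>, so \<open>r\<close> is the dimension of \<open>W\<close>, and
  \<open>Q\<close> computes coordinates in this basis.\<close>

lemma (in vec_space) subspace_adapted_basis:
  assumes W: "subspace class_ring W V"
  obtains P Q r where "P \<in> carrier_mat n n" "Q \<in> carrier_mat n n" "P * Q = 1\<^sub>m n" "Q * P = 1\<^sub>m n"
    and "r \<le> n" "\<And>j. j < r \<Longrightarrow> col P j \<in> W"
    and "\<And>w i. w \<in> W \<Longrightarrow> r \<le> i \<Longrightarrow> i < n \<Longrightarrow> (Q *\<^sub>v w) $ i = 0"
    and "W \<noteq> carrier_vec n \<Longrightarrow> r < n"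
proof -
  have sub: "submodule class_ring W V"
    using W by (simp add: subspace_def)
  have W_carrier: "W \<subseteq> carrier_vec n"
    using submodule.subset[OF sub] by simp
  have bound: "finite A \<and> card A \<le> n" if "A \<subseteq> carrier_vec n" "lin_indpt A" for A
    using li_le_dim[OF fin_dim, of A] that by (simp add: dim_is_n)
  have "\<exists>S. finite S \<and> maximal S (\<lambda>T. T \<subseteq> W \<and> lin_indpt T)"
    using W_carrier bound by (intro maximal_exists[of _ n "{}"]) (blast, simp add: lin_dep_def)
  then obtain S where S_maximal: "finite S" "maximal S (\<lambda>T. T \<subseteq> W \<and> lin_indpt T)"
    by blast
  then have S: "finite S" "S \<subseteq> W" "lin_indpt S"
    by (simp_all add: maximal_def)
  have S_max: "T = S" if "S \<subseteq> T" "T \<subseteq> W" "lin_indpt T" for T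
    using S_maximal(2) that by (simp add: maximal_def)
  \<comment> \<open>Extends the basis \<open>S\<close> of \<open>W\<close> to a maximal independent
    set, which is a basis of the whole space.\<close>
  have "\<exists>B. finite B \<and> maximal B (\<lambda>T. S \<subseteq> T \<and> T \<subseteq> carrier_vec n \<and> lin_indpt T)"
  proof (rule maximal_exists)
    show "finite A \<and> card A \<le> n" if "S \<subseteq> A \<and> A \<subseteq> carrier_vec n \<and> lin_indpt A" for A
      using bound that by blast
    show "S \<subseteq> S \<and> S \<subseteq> carrier_vec n \<and> lin_indpt S"
      using S W_carrier by blast
  qed
  then obtain B where B_maximal: "finite B"
      "maximal B (\<lambda>T. S \<subseteq> T \<and> T \<subseteq> carrier_vec n \<and> lin_indpt T)"
    by blast
  then have B: "finite B" "S \<subseteq> B" "B \<subseteq> carrier_vec n" "lin_indpt B"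
    by (simp_all add: maximal_def)
  have B_max: "maximal B (\<lambda>T. T \<subseteq> carrier_vec n \<and> lin_indpt T)"
    unfolding maximal_def
  proof (intro conjI allI impI)
    fix T assume T: "B \<subseteq> T \<and> T \<subseteq> carrier_vec n \<and> lin_indpt T"
    then have "S \<subseteq> T"
      using B(2) by (meson order_trans)
    then show "T = B"
      using T B_maximal(2) by (simp add: maximal_def)
  qed (fact B)+
  have basis: "basis B"
    using max_li_is_basis B_max by simp
  have card_B: "card B = n"
    using dim_basis[OF B(1) basis] by (simp add: dim_is_n)
  obtain ws where ws: "set ws = S" "distinct ws"
    using finite_distinct_list[OF S(1)] by blast
  obtain us where us: "set us = B - S" "distinct us"
    using finite_distinct_list[of "B - S"] B(1) by blast
  \<comment> \<open>Listing \<open>S\<close> first puts the vectors from \<open>W\<close> into the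
    first \<open>r\<close> columns of \<open>P\<close>.\<close>
  let ?vs = "ws @ us"
  have vs: "set ?vs = B" "distinct ?vs"
    using ws us B(2) by auto
  have len: "length ?vs = n"
    using distinct_card[OF vs(2)] vs(1) card_B by simp
  define r where "r = length ws"
  define P where "P = mat_of_cols n ?vs"
  have P: "P \<in> carrier_mat n n"
    using len by (simp add: P_def carrier_matI)
  have cols: "cols P = ?vs"
    unfolding P_def using vs(1) B(3) by (intro cols_mat_of_cols) simp
  have "det P \<noteq> 0"
    using lin_indpt_full_rank[OF P] det_rank_iff[OF P] cols vs B(4) by simp
  then obtain Q where Q: "Q \<in> carrier_mat n n" and PQ: "P * Q = 1\<^sub>m n" "Q * P = 1\<^sub>m n"
    using det_non_zero_imp_unit[OF P, of "()"] by (auto simp: Units_def ring_mat_simps)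
  have r: "r \<le> n"
    using len by (simp add: r_def)
  have col: "col P j \<in> W" if "j < r" for j
  proof -
    have "col P j = cols P ! j"
      using that r P by simp
    then show ?thesis
      using that ws S(2) by (auto simp: cols r_def nth_append)
  qed
  have coord: "(Q *\<^sub>v w) $ i = 0" if w: "w \<in> W" and i: "r \<le> i" "i < n" for w i
  proof -
    \<comment> \<open>By maximality of \<open>S\<close> inside \<open>W\<close>, adding a new
      \<open>w\<close> makes the set dependent, so \<open>w\<close> is already in its span.\<close>
    have "w \<in> span S"
    proof (cases "w \<in> S")
      case True
      then show ?thesis
        using in_own_span[of S] S W_carrier by auto
    next
      case False
      then have "lin_dep (S \<union> {w})"
        using S_max[of "S \<union> {w}"] S w by auto
      then show ?thesis
        using lin_dep_iff_in_span[of S w] False S w W_carrier by auto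
    qed
    then have "w \<in> span_list ws"
      using span_list_as_span[of ws] ws S W_carrier by auto
    then obtain c where c: "w = lincomb_list c ws"
      by (auto elim: in_span_listE)
    \<comment> \<open>The coefficients of \<open>w\<close> padded with zeros: then
      \<open>w = P *\<^sub>v x\<close>, so \<open>Q *\<^sub>v w = x\<close> vanishes from index
      \<open>r\<close> on.\<close>
    define x where "x = vec n (\<lambda>i. if i < r then c i else 0)"
    have "w = mat_of_cols n ws *\<^sub>v vec r c"
      unfolding c r_def using ws S W_carrier by (intro lincomb_list_as_mat_mult) auto
    also have "\<dots> = P *\<^sub>v x"
    proof (rule eq_vecI)
      fix k assume "k < dim_vec (P *\<^sub>v x)"
      then have k: "k < n"
        using P by simp
      have "(mat_of_cols n ws *\<^sub>v vec r c) $ k = (\<Sum>l<r. ws ! l $ k * c l)"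
        using k by (simp add: scalar_prod_def atLeast0LessThan r_def mat_of_cols_index)
      also have "\<dots> = (\<Sum>l<n. ?vs ! l $ k * x $ l)"
        using r by (intro sum.mono_neutral_cong_left) (auto simp: x_def r_def nth_append)
      also have "\<dots> = (P *\<^sub>v x) $ k"
        using k len by (simp add: scalar_prod_def atLeast0LessThan P_def mat_of_cols_index x_def)
      finally show "(mat_of_cols n ws *\<^sub>v vec r c) $ k = (P *\<^sub>v x) $ k" .
    qed (use P in simp)
    finally have "Q *\<^sub>v w = (Q * P) *\<^sub>v x"
      using P Q by (simp add: x_def assoc_mult_mat_vec[of _ n n _ n])
    then show ?thesis
      using i by (simp add: PQ x_def)
  qed
  have "r < n" if "W \<noteq> carrier_vec n"
  proof (rule ccontr)
    assume "\<not> r < n"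
    then have "card S \<ge> n"
      using ws distinct_card by (fastforce simp: r_def)
    then have "basis S"
      using dim_li_is_basis[OF fin_dim S(1)] S W_carrier by (simp add: dim_is_n)
    then have "carrier_vec n \<subseteq> W"
      using span_is_subset[OF S(2) sub] by (simp add: basis_def)
    then show False
      using that W_carrier by blast
  qed
  then show thesis
    using that P Q PQ r col coord by blast
qed

lemma sum_lessThan_add:
  fixes f :: "nat \<Rightarrow> 'a::comm_monoid_add"
  shows "(\<Sum>k < r + m. f k) = (\<Sum>k<r. f k) + (\<Sum>k<m. f (r + k))"
  by (induction m) (simp_all add: add.assoc)

lemma (in group_representation) conjugate:
  assumes "P \<in> carrier_mat n n" "Q \<in> carrier_mat n n" "P * Q = 1\<^sub>m n" "Q * P = 1\<^sub>m n"
  shows "group_representation G n (\<lambda>g. Q * (\<rho> g * P))"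
proof unfold_locales
  fix g h assume gh: "g \<in> carrier G" "h \<in> carrier G"
  note c = rep_closed[OF gh(1)] rep_closed[OF gh(2)] assms(1,2)
  note [simp] = assoc_mult_mat[of _ n n _ n _ n] mult_carrier_mat[of _ n n _ n]
  have "Q * (\<rho> g * P) * (Q * (\<rho> h * P)) = Q * (\<rho> g * ((P * Q) * (\<rho> h * P)))"
    using c by simp
  then show "Q * (\<rho> (g \<otimes> h) * P) = Q * (\<rho> g * P) * (Q * (\<rho> h * P))"
    using c gh by (simp add: assms(3) rep_mult)
qed (use assms in \<open>auto intro!: mult_carrier_mat[of _ n n _ n]\<close>)

lemma (in group_representation) trace_conjugate:
  assumes "P \<in> carrier_mat n n" "Q \<in> carrier_mat n n" "P * Q = 1\<^sub>m n" "g \<in> carrier G"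
  shows "trace (Q * (\<rho> g * P)) = trace (\<rho> g)"
proof -
  have "trace (Q * (\<rho> g * P)) = trace (\<rho> g * P * Q)"
    using assms by (intro trace_mult_comm[of _ n n] mult_carrier_mat[of _ n n]) auto
  also have "\<rho> g * P * Q = \<rho> g"
    using assms rep_closed[OF assms(4)] by (simp add: assoc_mult_mat[of _ n n _ n _ n] right_mult_one_mat[of _ n n])
  finally show ?thesis .
qed

text \<open>The first \<open>r\<close> coordinates span an invariant subspace;
  \<open>\<rho>1\<close> is the action on it and \<open>\<rho>2\<close> the action on the
  quotient.\<close>

lemma (in group_representation) block_triangular:
  assumes n: "n = r + m"
    and zero: "\<And>g i j. g \<in> carrier G \<Longrightarrow> r \<le> i \<Longrightarrow> i < n \<Longrightarrow> j < r \<Longrightarrow> \<rho> g $$ (i, j) = 0"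
  defines "\<rho>1 \<equiv> \<lambda>g. mat r r (\<lambda>(i, j). \<rho> g $$ (i, j))"
    and "\<rho>2 \<equiv> \<lambda>g. mat m m (\<lambda>(i, j). \<rho> g $$ (r + i, r + j))"
  shows "group_representation G r \<rho>1" "group_representation G m \<rho>2"
    and "\<And>g. g \<in> carrier G \<Longrightarrow> trace (\<rho> g) = trace (\<rho>1 g) + trace (\<rho>2 g)"
proof -
  \<comment> \<open>In the upper left block the second sum vanishes because of the zero block of
    \<open>\<rho> h\<close>, in the lower right block the first sum because of that of
    \<open>\<rho> g\<close>.\<close>
  have entry: "\<rho> (g \<otimes> h) $$ (i, j) = (\<Sum>k<r. \<rho> g $$ (i, k) * \<rho> h $$ (k, j))
      + (\<Sum>k<m. \<rho> g $$ (i, r + k) * \<rho> h $$ (r + k, j))"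
    if gh: "g \<in> carrier G" "h \<in> carrier G" and ij: "i < n" "j < n" for g h i j
  proof -
    have "\<rho> (g \<otimes> h) $$ (i, j) = (\<Sum>k<n. \<rho> g $$ (i, k) * \<rho> h $$ (k, j))"
      using rep_closed[OF gh(1), THEN carrier_matD(1)] rep_closed[OF gh(1), THEN carrier_matD(2)]
        rep_closed[OF gh(2), THEN carrier_matD(1)] rep_closed[OF gh(2), THEN carrier_matD(2)] ij gh
      by (simp add: rep_mult scalar_prod_def atLeast0LessThan)
    then show ?thesis
      by (simp add: n sum_lessThan_add)
  qed
  show "group_representation G r \<rho>1"
  proof unfold_locales
    show "\<rho>1 (g \<otimes> h) = \<rho>1 g * \<rho>1 h" if "g \<in> carrier G" "h \<in> carrier G" for g h
    proof (rule eq_matI)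
      fix i j assume "i < dim_row (\<rho>1 g * \<rho>1 h)" "j < dim_col (\<rho>1 g * \<rho>1 h)"
      then show "\<rho>1 (g \<otimes> h) $$ (i, j) = (\<rho>1 g * \<rho>1 h) $$ (i, j)"
        using that zero[of h] n by (simp add: \<rho>1_def entry scalar_prod_def atLeast0LessThan)
    qed (auto simp: \<rho>1_def)
  qed (auto simp: \<rho>1_def n intro!: eq_matI)
  show "group_representation G m \<rho>2"
  proof unfold_locales
    show "\<rho>2 (g \<otimes> h) = \<rho>2 g * \<rho>2 h" if "g \<in> carrier G" "h \<in> carrier G" for g h
    proof (rule eq_matI)
      fix i j assume "i < dim_row (\<rho>2 g * \<rho>2 h)" "j < dim_col (\<rho>2 g * \<rho>2 h)"
      then show "\<rho>2 (g \<otimes> h) $$ (i, j) = (\<rho>2 g * \<rho>2 h) $$ (i, j)"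
        using that zero[of g] n by (simp add: \<rho>2_def entry scalar_prod_def atLeast0LessThan)
    qed (auto simp: \<rho>2_def)
  qed (auto simp: \<rho>2_def n intro!: eq_matI)
  show "trace (\<rho> g) = trace (\<rho>1 g) + trace (\<rho>2 g)" if "g \<in> carrier G" for g
    using rep_closed[OF that] by (simp add: trace_def \<rho>1_def \<rho>2_def n sum_lessThan_add)
qed

text \<open>In a basis adapted to \<open>W\<close> all matrices become block triangular, with the
  same traces. Both blocks are smaller than \<open>n\<close> because \<open>W\<close> is neither
  zero nor everything.\<close>

lemma (in group_representation) reducible:
  assumes W: "invariant_subspace G n \<rho> W" and W_ne: "W \<noteq> {0\<^sub>v n}" "W \<noteq> carrier_vec n"
  obtains r m \<rho>1 \<rho>2 where "r < n" "m < n"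
    and "group_representation G r \<rho>1" "group_representation G m \<rho>2"
    and "\<And>g. g \<in> carrier G \<Longrightarrow> trace (\<rho> g) = trace (\<rho>1 g) + trace (\<rho>2 g)"
proof -
  interpret vec_space "TYPE(complex)" n .
  have sub: "subspace class_ring W V"
    using W by (simp add: invariant_subspace_def)
  have W_carrier: "W \<subseteq> carrier_vec n"
    using submodule.subset[of class_ring W V] sub by (simp add: subspace_def)
  obtain P Q r where PQ: "P \<in> carrier_mat n n" "Q \<in> carrier_mat n n" "P * Q = 1\<^sub>m n" "Q * P = 1\<^sub>m n"
    and r: "r \<le> n" and col: "\<And>j. j < r \<Longrightarrow> col P j \<in> W"
    and coord: "\<And>w i. w \<in> W \<Longrightarrow> r \<le> i \<Longrightarrow> i < n \<Longrightarrow> (Q *\<^sub>v w) $ i = 0"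
    and r_less: "W \<noteq> carrier_vec n \<Longrightarrow> r < n"
    by (rule subspace_adapted_basis[OF sub]) blast
  \<comment> \<open>For \<open>r = 0\<close> all coordinates of every vector in \<open>W\<close>
    would vanish.\<close>
  have "0 < r"
  proof (rule ccontr)
    assume "\<not> 0 < r"
    have "w = 0\<^sub>v n" if w: "w \<in> W" for w
    proof -
      have w': "w \<in> carrier_vec n"
        using w W_carrier by blast
      have "Q *\<^sub>v w = 0\<^sub>v n"
        using coord[OF w] PQ \<open>\<not> 0 < r\<close> by (intro eq_vecI) auto
      then have "P *\<^sub>v (Q *\<^sub>v w) = 0\<^sub>v n"
        using PQ by (auto intro!: eq_vecI)
      then show ?thesis
        using PQ w' by (simp add: assoc_mult_mat_vec[of _ n n _ n, symmetric])
    qed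
    moreover have "0\<^sub>v n \<in> W"
      using sub by (simp add: subspace_def submodule_def)
    ultimately show False
      using W_ne(1) by blast
  qed
  let ?\<sigma> = "\<lambda>g. Q * (\<rho> g * P)"
  interpret \<sigma>: group_representation G n ?\<sigma>
    using conjugate[OF PQ] .
  \<comment> \<open>The \<open>j\<close>-th column of the conjugated matrix holds the coordinates of
    \<open>\<rho> g *\<^sub>v col P j\<close>, which is in \<open>W\<close> by invariance.\<close>
  have zero: "?\<sigma> g $$ (i, j) = 0" if "g \<in> carrier G" "r \<le> i" "i < n" "j < r" for g i j
  proof -
    have "?\<sigma> g $$ (i, j) = (Q *\<^sub>v (\<rho> g *\<^sub>v col P j)) $ i"
      using that r PQ rep_closed[OF that(1)]
      by (simp add: col_mult2[of _ n n _ n, symmetric] del: col_mult2)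
    moreover have "\<rho> g *\<^sub>v col P j \<in> W"
      using W that(1) col[OF that(4)] by (simp add: invariant_subspace_def)
    ultimately show ?thesis
      using coord that by simp
  qed
  note blocks = \<sigma>.block_triangular[of r "n - r", OF _ zero]
  show thesis
    using blocks r r_less[OF W_ne(2)] \<open>0 < r\<close> trace_conjugate[OF PQ(1-3)]
    by (intro that[of r "n - r"]) auto
qed

lemma (in group_representation) irreducible_or_reducible:
  assumes "0 < n"
  obtains "irreducible_representation G n \<rho>"
  | W where "invariant_subspace G n \<rho> W" "W \<noteq> {0\<^sub>v n}" "W \<noteq> carrier_vec n"
  using assms group_representation_axioms
  unfolding irreducible_representation_def group_representation_iff by blast


section \<open>The regular character and subgroup indices\<close>

section \<open>The regular representation\<close>

text \<open>Permutation matrices of left multiplication, with rows and columns numbered by an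
  enumeration \<open>e\<close> of the group. The trace counts fixed points, and only the identity
  has any.\<close>

lemma (in group) regular_representation:
  assumes fin: "finite (carrier G)"
  obtains \<rho> where "group_representation G (Coset.order G) \<rho>"
    and "\<And>g. g \<in> carrier G \<Longrightarrow> trace (\<rho> g) = (if g = \<one> then of_nat (Coset.order G) else 0)"
proof -
  let ?N = "Coset.order G"
  obtain e where e: "bij_betw e {..<?N} (carrier G)"
    using ex_bij_betw_nat_finite[OF fin] unfolding Coset.order_def atLeast0LessThan by blast
  have e_closed: "e i \<in> carrier G" if "i < ?N" for i
    using e that by (auto simp: bij_betw_def)
  have e_eq: "e i = e j \<longleftrightarrow> i = j" if "i < ?N" "j < ?N" for i j
    using e that by (auto simp: bij_betw_def inj_on_def)
  define \<rho> :: "'a \<Rightarrow> complex mat" where "\<rho> g = mat ?N ?N (\<lambda>(i, j). if e i = g \<otimes> e j then 1 else 0)" for g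
  have "group_representation G ?N \<rho>"
  proof unfold_locales
    fix g h assume gh: "g \<in> carrier G" "h \<in> carrier G"
    show "\<rho> (g \<otimes> h) = \<rho> g * \<rho> h"
    proof (rule eq_matI)
      fix i j assume "i < dim_row (\<rho> g * \<rho> h)" "j < dim_col (\<rho> g * \<rho> h)"
      then have ij: "i < ?N" "j < ?N"
        by (simp_all add: \<rho>_def)
      have "(\<rho> g * \<rho> h) $$ (i, j) =
          (\<Sum>k<?N. (if e i = g \<otimes> e k then 1 else 0) * (if e k = h \<otimes> e j then 1 else 0))"
        using ij by (simp add: \<rho>_def scalar_prod_def atLeast0LessThan)
      \<comment> \<open>Summing over group elements instead of indices lets the second factor select
        the single term \<open>x = h \<otimes> e j\<close>.\<close>
      also have "\<dots> = (\<Sum>x \<in> carrier G. (if e i = g \<otimes> x then 1 else 0) * (if x = h \<otimes> e j then 1 else 0))"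
        by (rule sum.reindex_bij_betw[OF e])
      also have "\<dots> = (\<Sum>x \<in> carrier G. if x = h \<otimes> e j then (if e i = g \<otimes> x then 1 else 0) else 0)"
        by (intro sum.cong) auto
      also have "\<dots> = \<rho> (g \<otimes> h) $$ (i, j)"
        using gh ij e_closed fin by (simp add: \<rho>_def m_assoc)
      finally show "\<rho> (g \<otimes> h) $$ (i, j) = (\<rho> g * \<rho> h) $$ (i, j)" ..
    qed (simp_all add: \<rho>_def)
  qed (auto simp: \<rho>_def e_closed e_eq intro!: eq_matI)
  moreover have "trace (\<rho> g) = (if g = \<one> then of_nat ?N else 0)" if "g \<in> carrier G" for g
    using that e_closed by (simp add: trace_def \<rho>_def)
  ultimately show thesis
    using that by blast
qed

text \<open>Only the identity contributes, which leaves |G| / |K|, the index by Lagrange.\<close>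

lemma (in group) mean_trace_regular:
  assumes fin: "finite (carrier G)" and K: "subgroup K G"
    and tr: "\<And>g. g \<in> carrier G \<Longrightarrow> trace (\<rho> g) = (if g = \<one> then of_nat (Coset.order G) else 0)"
  shows "mean_trace \<rho> K = of_nat (index G K)"
proof -
  interpret K: subgroup K G by fact
  have finK: "finite K"
    using K.subset fin by (rule finite_subset)
  have "(\<Sum>k \<in> K. trace (\<rho> k)) = (\<Sum>k \<in> K. if k = \<one> then of_nat (Coset.order G) else 0)"
    using tr by (intro sum.cong) auto
  also have "\<dots> = of_nat (Coset.order G)"
    using finK K.one_closed by simp
  finally have "mean_trace \<rho> K = of_nat (Coset.order G) / of_nat (card K)"
    by (simp add: mean_trace_def)
  also have "Coset.order G = index G K * card K"
    using lagrange[OF K] by (simp add: index_def)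
  moreover have "card K \<noteq> 0"
    using finK K.one_closed by (metis card_eq_0_iff empty_iff)
  ultimately show ?thesis
    by simp
qed


section \<open>Vanishing of the Moebius sum for every representation\<close>

section \<open>The dual Euler totient\<close>

text \<open>Strong induction on the degree: a reducible representation splits into two of smaller
  degree. Degree 0 is treated apart, since irreducibility demands \<open>n > 0\<close>; the failure
  of linear primitivity enters in the irreducible case.\<close>

lemma mobius_sum_mean_trace_zero:
  assumes G: "group G" and fin: "finite (carrier G)" and H: "subgroup H G"
    and not_primitive: "\<not> linearly_primitive G H"
    and rep: "group_representation G n \<rho>"
  defines "L \<equiv> subgroup_interval G H (carrier G)"
  shows "(\<Sum>K \<in> carrier L. of_int (mobius L H K) * mean_trace \<rho> K) = 0"
  using rep
proof (induction n arbitrary: \<rho> rule: less_induct)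
  case (less n)
  interpret group_representation G n \<rho> by fact
  have L: "carrier L = {K. subgroup K G \<and> H \<subseteq> K}" "le L = (\<subseteq>)"
    by (simp_all add: L_def carrier_subgroup_interval)
  show ?case
  proof (cases "n = 0")
    case True
    then have "trace (\<rho> g) = 0" if "g \<in> carrier G" for g
      using rep_closed[OF that] by (simp add: trace_def)
    then have "mean_trace \<rho> K = 0" if "subgroup K G" for K
      using subgroup.subset[OF that] by (auto simp: mean_trace_def intro!: sum.neutral)
    then show ?thesis
      by (simp add: L)
  next
    case False
    then consider "irreducible_representation G n \<rho>"
      | W where "invariant_subspace G n \<rho> W" "W \<noteq> {0\<^sub>v n}" "W \<noteq> carrier_vec n"
      using irreducible_or_reducible by blast
    then show ?thesis
    proof cases
      case 1
      define S where "S = pointwise_stabilizer G \<rho> (fixed_vectors n \<rho> H)"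
      have S: "subgroup S G"
        unfolding S_def by (rule subgroup_pointwise_stabilizer) (auto simp: fixed_vectors_def)
      have "H \<subseteq> S"
        using subgroup.subset[OF H] by (auto simp: S_def pointwise_stabilizer_def fixed_vectors_def)
      \<comment> \<open>Otherwise \<open>\<rho>\<close> itself would witness linear primitivity.
        This makes \<open>S\<close> an admissible element to join with in Weisner's theorem.\<close>
      have "S \<noteq> H"
        using not_primitive 1 by (auto simp: S_def linearly_primitive_def)
      let ?j = "\<lambda>K. generate G (K \<union> S)"
      have j: "subgroup (?j K) G" "H \<subseteq> ?j K" if "subgroup K G" for K
        using that S \<open>H \<subseteq> S\<close> subgroup.subset[of _ G]
        by (auto intro!: generate_is_subgroup intro: generate.incl)
      \<comment> \<open>Vectors fixed by \<open>K\<close> are fixed by \<open>H\<close>, hence by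
        \<open>S\<close>, so passing to the join with \<open>S\<close> loses no fixed
        vectors.\<close>
      have trace_j: "mean_trace \<rho> (?j K) = mean_trace \<rho> K" if K: "subgroup K G" "H \<subseteq> K" for K
      proof (rule mean_trace_eq)
        have "fixed_vectors n \<rho> (?j K) = fixed_vectors n \<rho> (K \<union> S)"
          using K S by (intro fixed_vectors_generate) (simp add: subgroup.subset)
        also have "\<dots> = fixed_vectors n \<rho> K"
        proof
          show "fixed_vectors n \<rho> (K \<union> S) \<subseteq> fixed_vectors n \<rho> K"
            by (auto simp: fixed_vectors_def)
          show "fixed_vectors n \<rho> K \<subseteq> fixed_vectors n \<rho> (K \<union> S)"
          proof
            fix v assume v: "v \<in> fixed_vectors n \<rho> K"
            then have "v \<in> fixed_vectors n \<rho> H"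
              using K(2) by (auto simp: fixed_vectors_def)
            then have "\<rho> g *\<^sub>v v = v" if "g \<in> S" for g
              using that by (simp add: S_def pointwise_stabilizer_def)
            then show "v \<in> fixed_vectors n \<rho> (K \<union> S)"
              using v by (auto simp: fixed_vectors_def)
          qed
        qed
        finally show "fixed_vectors n \<rho> (?j K) = fixed_vectors n \<rho> K" .
        show "finite (?j K)" "finite K"
          using j[OF K(1)] K(1) fin finite_subset subgroup.subset by blast+
      qed (use j K in auto)
      show ?thesis
      proof (rule sum_mobius_join_invariant[where a = S and j = ?j])
        show "partial_order L"
          unfolding L_def by (rule partial_order_subgroup_interval)
        show "finite (carrier L)"
          using fin subgroup.subset[of _ G] by (auto simp: L intro!: finite_subset[of _ "Pow (carrier G)"])
      qed (use H S j trace_j \<open>H \<subseteq> S\<close> \<open>S \<noteq> H\<close> generate_Un_subset_iff in \<open>auto simp: L\<close>)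
    next
      case 2
      then obtain r m \<rho>1 \<rho>2 where "r < n" "m < n"
        and rep12: "group_representation G r \<rho>1" "group_representation G m \<rho>2"
        and tr: "\<And>g. g \<in> carrier G \<Longrightarrow> trace (\<rho> g) = trace (\<rho>1 g) + trace (\<rho>2 g)"
        by (rule reducible) blast
      have "mean_trace \<rho> K = mean_trace \<rho>1 K + mean_trace \<rho>2 K" if "subgroup K G" for K
      proof -
        have "(\<Sum>k \<in> K. trace (\<rho> k)) = (\<Sum>k \<in> K. trace (\<rho>1 k) + trace (\<rho>2 k))"
          using tr subgroup.subset[OF that] by (intro sum.cong) auto
        then show ?thesis
          by (simp add: mean_trace_def sum.distrib add_divide_distrib)
      qed
      then have "(\<Sum>K \<in> carrier L. of_int (mobius L H K) * mean_trace \<rho> K) =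
          (\<Sum>K \<in> carrier L. of_int (mobius L H K) * mean_trace \<rho>1 K) +
          (\<Sum>K \<in> carrier L. of_int (mobius L H K) * mean_trace \<rho>2 K)"
        unfolding sum.distrib[symmetric] by (intro sum.cong) (simp_all add: L distrib_left)
      then show ?thesis
        using less.IH[OF \<open>r < n\<close> rep12(1)] less.IH[OF \<open>m < n\<close> rep12(2)] by simp
    qed
  qed
qed

theorem corollary3p23:
  fixes G :: "('a, 'b) monoid_scheme" and H :: "'a set"
  assumes "group G" and "finite (carrier G)" and "subgroup H G"
    and "bottom_boolean G H"
    and "dual_euler_totient G H \<noteq> 0"
  shows "linearly_primitive G H"
proof (rule ccontr)
  assume not_primitive: "\<not> linearly_primitive G H"
  interpret group G by fact
  let ?L = "subgroup_interval G H (carrier G)"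
  obtain \<rho> where rep: "group_representation G (Coset.order G) \<rho>"
    and tr: "\<And>g. g \<in> carrier G \<Longrightarrow> trace (\<rho> g) = (if g = \<one>\<^bsub>G\<^esub> then of_nat (Coset.order G) else 0)"
    using regular_representation[OF assms(2)] by blast
  \<comment> \<open>For the regular representation the mean trace over \<open>K\<close> is the index
    of \<open>K\<close>, which turns the totient into the vanishing Moebius sum.\<close>
  have "of_int (dual_euler_totient G H) = (\<Sum>K \<in> carrier ?L. of_int (mobius ?L H K) * mean_trace \<rho> K)"
    using mean_trace_regular[OF assms(2) _ tr]
    by (simp add: dual_euler_totient_def Let_def carrier_subgroup_interval)
  also have "\<dots> = 0"
    by (rule mobius_sum_mean_trace_zero) fact+
  finally show False
    using assms(5) by simp
qed

end
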